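(* Consider a finite timestep set $\mathcal{T}$ and a layer $\ell$. For each $t\in\mathcal{T}$ let $[L_{\ell,t},U_{\ell,t}]$ be an acceptable perturbation-budget interval, where $0\leq L_{\ell,t}\leq U_{\ell,t}$. Suppose a nonnegative uniform scaling $\alpha_0$ (one number used at all timesteps) must satisfy all perturbation-budget constraints $$L_{\ell,t}\leq \frac{\alpha_0}{r}\,b_\ell a_\ell H_{\ell,t}\leq U_{\ell,t},\qquad t\in\mathcal{T}.$$ Such an $\alpha_0$ exists if and only if the intervals $$\left[\frac{rL_{\ell,t}}{b_\ell a_\ell H_{\ell,t}},\ \frac{rU_{\ell,t}}{b_\ell a_\ell H_{\ell,t}}\right],\qquad t\in\mathcal{T},$$ have a nonempty intersection. If the intersection is empty, any uniform scaling violates the budget constraint of at least one timestep. If $\alpha(t)$ is allowed to vary with $t$ and each interval is nonempty, then timestep-wise scaling can satisfy all budget constraints (the same inequalities with $\alpha(t)$ in place of $\alpha_0$ at timestep $t$) by choosing $\alpha(t)$ inside the corresponding interval.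
   Context: A layer $\ell$ carries a low-rank adapter with weight update $\frac{\alpha(t)}{r}B_\ell A_\ell$ at timestep $t$, where $A_\ell\in\mathbb{R}^{r\times d_\ell^{\mathrm{in}}}$ and $B_\ell\in\mathbb{R}^{d_\ell^{\mathrm{out}}\times r}$ are the low-rank matrices, $r$ is the rank, and $\alpha(t)$ is the adapter scaling; the scaling is uniform if $\alpha(t)=\alpha_0$ for all $t$. The numbers $a_\ell$, $b_\ell$ and the finite constant $H_{\ell,t}$ are upper bounds: $\|A_\ell\|_2\leq a_\ell$ and $\|B_\ell\|_2\leq b_\ell$ (spectral norms), and $\|h_{\ell,t}\|_2\leq H_{\ell,t}$ for the layer input feature $h_{\ell,t}\in\mathbb{R}^{d_\ell^{\mathrm{in}}}$ at timestep $t$. The adapter-induced output perturbation $\delta_{\ell,t}=\frac{\alpha(t)}{r}B_\ell A_\ell h_{\ell,t}$ then satisfies $\|\delta_{\ell,t}\|_2\leq\frac{|\alpha(t)|}{r}b_\ell a_\ell H_{\ell,t}$, and the budget constraints are imposed on the right-hand side of this bound. The interval $[L_{\ell,t},U_{\ell,t}]$ is an abstract given object (for a fixed data distribution and evaluation objective). *)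

theory Defs
  imports "HOL-Analysis.Analysis"
begin

text \<open>
  The spectral norm of a matrix \<open>M\<close> is the operator norm \<open>onorm ((*v) M)\<close> with respect to the
  Euclidean norms.
\<close>
abbreviation spectral_norm :: "real ^ 'n ^ 'm \<Rightarrow> real" where
  "spectral_norm M \<equiv> onorm ((*v) M)"

text \<open>
  For \<open>\<alpha> \<ge> 0\<close>, the value \<open>\<alpha> / r * b * a * H\<close> is the upper bound on the norm of the
  adapter-induced perturbation \<open>(\<alpha> / r) B A h\<close> that follows from \<open>\<parallel>A\<parallel> \<le> a\<close>, \<open>\<parallel>B\<parallel> \<le> b\<close>
  and \<open>\<parallel>h\<parallel> \<le> H\<close>. The budget \<open>[L, U]\<close> is imposed on this bound, not on the perturbation itself.
\<close>
definition meets_budget ::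
  "nat \<Rightarrow> real \<Rightarrow> real \<Rightarrow> real \<Rightarrow> real \<Rightarrow> real \<Rightarrow> real \<Rightarrow> bool" where
  "meets_budget r a b H L U \<alpha> \<longleftrightarrow>
     L \<le> \<alpha> / real r * b * a * H \<and> \<alpha> / real r * b * a * H \<le> U"

definition scaling_interval ::
  "nat \<Rightarrow> real \<Rightarrow> real \<Rightarrow> real \<Rightarrow> real \<Rightarrow> real \<Rightarrow> real set" where
  "scaling_interval r a b H L U = {real r * L / (b * a * H) .. real r * U / (b * a * H)}"

end

theory Submission imports Defs begin

text \<open>For positive \<open>r\<close> and \<open>b * a * H\<close>, the map from \<alpha> to
  \<open>\<alpha> / r * b * a * H\<close> is linear and increasing, so the budget at one timestep
  says exactly that \<alpha> lies in its scaling interval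
  (\<open>meets_budget_iff_scaling_interval\<close>). A uniform scaling is then a common point of
  all the intervals, while a varying one is an independent choice of a point in each.\<close>

lemma meets_budget_iff_scaling_interval:
  assumes "r > 0" and "b * a * H > 0"
  shows "meets_budget r a b H L U \<alpha> \<longleftrightarrow> \<alpha> \<in> scaling_interval r a b H L U"
  using assms
  by (simp add: meets_budget_def scaling_interval_def pos_le_divide_eq pos_divide_le_eq ac_simps)

lemma spectral_norm_nonneg: "0 \<le> spectral_norm M"
  by (intro onorm_pos_le matrix_vector_mul_bounded_linear)

theorem proposition4p4:
  fixes A :: "real ^ 'din ^ 'r"
    and B :: "real ^ 'r ^ 'dout"
    and h :: "'time \<Rightarrow> real ^ 'din"
    and a b :: real
    and H L U :: "'time \<Rightarrow> real"
    and T :: "'time set"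
    and r :: nat
  assumes rank: "r = CARD('r)"
    and A_bound: "spectral_norm A \<le> a"
    and B_bound: "spectral_norm B \<le> b"
    and h_bound: "\<And>t. t \<in> T \<Longrightarrow> norm (h t) \<le> H t"
    and denominators: "\<And>t. t \<in> T \<Longrightarrow> b * a * H t \<noteq> 0"
    and finite_T: "finite T"
    and budget: "\<And>t. t \<in> T \<Longrightarrow> 0 \<le> L t \<and> L t \<le> U t"
  shows
    "((\<exists>\<alpha>0\<ge>0. \<forall>t\<in>T. meets_budget r a b (H t) (L t) (U t) \<alpha>0)
        \<longleftrightarrow> (\<Inter>t\<in>T. scaling_interval r a b (H t) (L t) (U t)) \<noteq> {})
     \<and> ((\<Inter>t\<in>T. scaling_interval r a b (H t) (L t) (U t)) = {}
        \<longrightarrow> (\<forall>\<alpha>0. \<exists>t\<in>T. \<not> meets_budget r a b (H t) (L t) (U t) \<alpha>0))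
     \<and> ((\<forall>t\<in>T. scaling_interval r a b (H t) (L t) (U t) \<noteq> {})
        \<longrightarrow> (\<exists>\<alpha>. \<forall>t\<in>T. \<alpha> t \<in> scaling_interval r a b (H t) (L t) (U t))
          \<and> (\<forall>\<alpha>. (\<forall>t\<in>T. \<alpha> t \<in> scaling_interval r a b (H t) (L t) (U t))
                \<longrightarrow> (\<forall>t\<in>T. meets_budget r a b (H t) (L t) (U t) (\<alpha> t))))"
proof -
  have "r > 0"
    by (simp add: rank)
  \<comment> \<open>Each factor bounds a norm from above, hence is nonnegative; a nonzero product is
    therefore positive, so dividing by it preserves inequalities.\<close>
  have pos: "b * a * H t > 0" if "t \<in> T" for t
  proof -
    have "0 \<le> a" "0 \<le> b" "0 \<le> H t"
      using A_bound B_bound h_bound[OF that] spectral_norm_nonneg[of A] spectral_norm_nonneg[of B]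
        norm_ge_zero[of "h t"] by linarith+
    then show ?thesis
      using denominators[OF that] by (simp add: less_le)
  qed
  let ?I = "\<lambda>t. scaling_interval r a b (H t) (L t) (U t)"
  have meets: "meets_budget r a b (H t) (L t) (U t) \<alpha> \<longleftrightarrow> \<alpha> \<in> ?I t" if "t \<in> T" for t \<alpha>
    using \<open>r > 0\<close> pos[OF that] by (rule meets_budget_iff_scaling_interval)
  \<comment> \<open>Since \<open>0 \<le> L t\<close>, the left endpoint is nonnegative; the sign
    condition on a uniform scaling thus comes for free once some timestep constrains it.\<close>
  have nonneg: "0 \<le> \<alpha>" if "t \<in> T" "\<alpha> \<in> ?I t" for t \<alpha>
  proof -
    have "0 \<le> real r * L t / (b * a * H t)"
      using budget[OF that(1)] pos[OF that(1)] by simp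
    then show ?thesis
      using that(2) by (simp add: scaling_interval_def)
  qed
  have "(\<exists>\<alpha>0\<ge>0. \<forall>t\<in>T. \<alpha>0 \<in> ?I t) \<longleftrightarrow> (\<Inter>t\<in>T. ?I t) \<noteq> {}"
  \<comment> \<open>With no timestep, \<open>nonneg\<close> has nothing to apply to, but the
    intersection is all of the reals and any nonnegative number is a witness.\<close>
  proof (cases "T = {}")
    case True
    then show ?thesis by auto
  next
    case False
    then show ?thesis using nonneg by blast
  qed
  moreover have "\<exists>\<alpha>. \<forall>t\<in>T. \<alpha> t \<in> ?I t" if "\<forall>t\<in>T. ?I t \<noteq> {}"
    using that by (intro bchoice) blast
  ultimately show ?thesis
    \<comment> \<open>\<open>meets\<close> holds for \<alpha> of either sign, so an empty
      intersection also rules out negative uniform scalings.\<close>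
    using meets by (auto simp: INT_iff)
qed

end
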